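(* Let $a,b>0$ and $p_0(1),p_0(2)\ge 0$ with $p_0(1)+p_0(2)>0$, and set $\rho=a+b-|p_0(1)-p_0(2)|$. For each integer $N\ge 2$, let $\lambda_N$ be the spectral gap of the Fleming-Viot process with $N$ particles on the two point space $\{1,2\}$ (generator $\mathcal{L}$ given in the context). If $\rho\le 0$, then there exists $c>0$ (not depending on $N$) such that $$\forall N\ge 2,\qquad \lambda_N>c .$$
   Context: The underlying absorbed chain lives on $\{0,1,2\}$ with $0$ absorbing, jumps $1\to2$ at rate $a$, $2\to1$ at rate $b$, and $i\to 0$ at rate $p_0(i)$. The Fleming-Viot process with $N$ particles is the Markov process on $E=\{\eta=(\eta(1),\eta(2))\in\mathbb{N}^2:\eta(1)+\eta(2)=N\}$ (with $\mathbb{N}=\{0,1,2,\dots\}$) with generator $$\mathcal{L}f(\eta)=\eta(1)\Bigl(a+p_0(1)\tfrac{\eta(2)}{N-1}\Bigr)\bigl(f(T_{1\to2}\eta)-f(\eta)\bigr)+\eta(2)\Bigl(b+p_0(2)\tfrac{\eta(1)}{N-1}\Bigr)\bigl(f(T_{2\to1}\eta)-f(\eta)\bigr),$$ where $T_{1\to 2}\eta=(\eta(1)-1,\eta(2)+1)$ and $T_{2\to1}\eta=(\eta(1)+1,\eta(2)-1)$. It is reversible with respect to its unique invariant probability measure. The spectral gap $\lambda_N$ is the smallest positive eigenvalue of $-\mathcal{L}$; equivalently, that of $-\mathcal G$, where $\mathcal{G}$ is the generator of the birth and death process $(\eta_t(1))_{t\ge0}$ on $\{0,\dots,N\}$ with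 birth rates $b_n=(N-n)\bigl(b+p_0(2)\frac{n}{N-1}\bigr)$ and death rates $d_n=n\bigl(a+p_0(1)\frac{N-n}{N-1}\bigr)$. *)

theory Defs
  imports "HOL-Analysis.Analysis"
begin

definition FV_states :: "nat \<Rightarrow> (nat \<times> nat) set" where
  "FV_states N = {\<eta>. fst \<eta> + snd \<eta> = N}"

definition T12 :: "nat \<times> nat \<Rightarrow> nat \<times> nat" where
  "T12 \<eta> = (fst \<eta> - 1, snd \<eta> + 1)"

definition T21 :: "nat \<times> nat \<Rightarrow> nat \<times> nat" where
  "T21 \<eta> = (fst \<eta> + 1, snd \<eta> - 1)"

text \<open>
  The generator is written on functions on all pairs of naturals. Truncated subtraction in
  \<open>T12\<close>, \<open>T21\<close> only matters when the departure site is empty, and then the rate in front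
  is zero; so on \<open>FV_states N\<close> the value depends only on the restriction of \<open>f\<close> to
  \<open>FV_states N\<close> (lemma \<open>FV_generator_cong\<close>).
\<close>

definition FV_generator ::
  "real \<Rightarrow> real \<Rightarrow> (nat \<Rightarrow> real) \<Rightarrow> nat \<Rightarrow> (nat \<times> nat \<Rightarrow> real) \<Rightarrow> nat \<times> nat \<Rightarrow> real" where
  "FV_generator a b p0 N f \<eta> =
     real (fst \<eta>) * (a + p0 1 * (real (snd \<eta>) / (real N - 1))) * (f (T12 \<eta>) - f \<eta>)
   + real (snd \<eta>) * (b + p0 2 * (real (fst \<eta>) / (real N - 1))) * (f (T21 \<eta>) - f \<eta>)"

lemma FV_generator_cong:
  assumes "\<And>\<xi>. \<xi> \<in> FV_states N \<Longrightarrow> f \<xi> = g \<xi>" and "\<eta> \<in> FV_states N"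
  shows "FV_generator a b p0 N f \<eta> = FV_generator a b p0 N g \<eta>"
proof -
  have "f \<eta> = g \<eta>" using assms by blast
  moreover have "fst \<eta> \<noteq> 0 \<Longrightarrow> f (T12 \<eta>) = g (T12 \<eta>)"
    using assms by (auto simp: FV_states_def T12_def)
  moreover have "snd \<eta> \<noteq> 0 \<Longrightarrow> f (T21 \<eta>) = g (T21 \<eta>)"
    using assms by (auto simp: FV_states_def T21_def)
  ultimately show ?thesis
    by (cases "fst \<eta> = 0"; cases "snd \<eta> = 0") (simp_all add: FV_generator_def)
qed

text \<open>\<open>l\<close> is an eigenvalue of the operator \<open>A\<close> on real functions on \<open>S\<close>; an eigenfunction
  has to be nonzero somewhere on \<open>S\<close>, its values outside \<open>S\<close> being irrelevant.\<close>

definition eigenvalue_on :: "'s set \<Rightarrow> (('s \<Rightarrow> real) \<Rightarrow> 's \<Rightarrow> real) \<Rightarrow> real \<Rightarrow> bool" where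
  "eigenvalue_on S A l \<longleftrightarrow> (\<exists>f. (\<exists>x\<in>S. f x \<noteq> 0) \<and> (\<forall>x\<in>S. A f x = l * f x))"

text \<open>\<open>Least\<close> carries no information unless a smallest positive eigenvalue exists, so a proof of
  a bound on the gap has to establish its existence. Real eigenvalues suffice, since the
  generator is reversible.\<close>

definition FV_spectral_gap :: "real \<Rightarrow> real \<Rightarrow> (nat \<Rightarrow> real) \<Rightarrow> nat \<Rightarrow> real" where
  "FV_spectral_gap a b p0 N =
     (LEAST l. 0 < l \<and> eigenvalue_on (FV_states N) (\<lambda>f \<eta>. - FV_generator a b p0 N f \<eta>) l)"

end

theory Submission
  imports Defs
begin

text \<open>
  The number of particles at site \<open>1\<close> is a reversible birth and death chain, so minimising the
  Rayleigh quotient over mean-zero functions shows that the spectral gap exists and is positive for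
  every \<open>N\<close>. By symmetry assume \<open>p0 1 \<le> p0 2\<close>. The increments of an eigenfunction satisfy a
  tridiagonal equation; evaluating it where \<open>(n + 1) * \<bar>f (n + 1) - f n\<bar>\<close> is maximal gives
  \<open>\<lambda> \<ge> b / 2\<close> for all large \<open>N\<close>. The weight \<open>1 / (n + 1)\<close> decreases fastest near \<open>0\<close>, which
  exploits the upward drift \<open>b * N\<close> there to make up for the negative curvature.
  Only finitely many \<open>N\<close> remain.
\<close>

section \<open>Preliminaries: a first-order condition and compact boxes of functions\<close>

lemma nonneg_quadratic_imp_linear_coeff_eq_0:
  fixes B C :: real
  assumes "\<And>t. 0 \<le> 2 * t * B + t\<^sup>2 * C"
  shows "B = 0"
proof (rule ccontr)
  assume "B \<noteq> 0"
  \<comment> \<open>Since \<open>D\<close> exceeds \<open>\<bar>C\<bar>\<close>, the linear term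
    dominates at \<open>t = - B / D\<close> and makes the quadratic negative.\<close>
  define D where "D = \<bar>C\<bar> + 1"
  have "D > 0" by (simp add: D_def)
  have "2 * (- B / D) * B + (- B / D)\<^sup>2 * C = B\<^sup>2 * (C - 2 * D) / D\<^sup>2"
    using \<open>D > 0\<close> by (simp add: field_simps power2_eq_square)
  moreover have "B\<^sup>2 * (C - 2 * D) < 0"
    using \<open>B \<noteq> 0\<close> by (intro mult_pos_neg) (auto simp: D_def)
  ultimately have "2 * (- B / D) * B + (- B / D)\<^sup>2 * C < 0"
    using \<open>D > 0\<close> by (simp add: divide_neg_pos)
  then show False using assms[of "- B / D"] by linarith
qed

text \<open>Tychonoff's theorem in the product topology; the index type may be infinite.\<close>

lemma compact_box_fun:
  fixes l u :: "'s \<Rightarrow> real"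
  shows "compact {f. \<forall>x. f x \<in> {l x..u x}}"
proof -
  have "compactin (product_topology (\<lambda>_. euclidean) UNIV) (PiE UNIV (\<lambda>x. {l x..u x}))"
    by (subst compactin_PiE) auto
  moreover have "PiE UNIV (\<lambda>x. {l x..u x}) = {f. \<forall>x. f x \<in> {l x..u x}}"
    by (auto simp: PiE_def Pi_def)
  ultimately show ?thesis
    by (simp add: euclidean_product_topology)
qed

section \<open>Least positive eigenvalue of a reversible operator on a finite set\<close>

locale reversible_operator =
  fixes S :: "'s set" and w :: "'s \<Rightarrow> real" and A :: "('s \<Rightarrow> real) \<Rightarrow> 's \<Rightarrow> real"
  assumes fin: "finite S"
    and w_pos: "x \<in> S \<Longrightarrow> 0 < w x"
    and local_on: "(\<And>y. y \<in> S \<Longrightarrow> f y = g y) \<Longrightarrow> x \<in> S \<Longrightarrow> A f x = A g x"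
    and linear: "x \<in> S \<Longrightarrow> A (\<lambda>y. f y + t * g y) x = A f x + t * A g x"
    and cont: "x \<in> S \<Longrightarrow> continuous_on UNIV (\<lambda>f. A f x)"
    and sym: "(\<Sum>x\<in>S. w x * (f x * A g x)) = (\<Sum>x\<in>S. w x * (A f x * g x))"
    and const: "x \<in> S \<Longrightarrow> A (\<lambda>_. 1) x = 0"
begin

text \<open>The weights are not normalised, so this is the mean up to a positive factor; its
  vanishing expresses orthogonality to the constants.\<close>

definition mean :: "('s \<Rightarrow> real) \<Rightarrow> real" where
  "mean f = (\<Sum>x\<in>S. w x * f x)"

definition sq :: "('s \<Rightarrow> real) \<Rightarrow> real" where
  "sq f = (\<Sum>x\<in>S. w x * (f x)\<^sup>2)"

definition energy :: "('s \<Rightarrow> real) \<Rightarrow> real" where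
  "energy f = (\<Sum>x\<in>S. w x * (f x * A f x))"

lemma sq_nonneg: "0 \<le> sq f"
  unfolding sq_def using w_pos by (intro sum_nonneg) (auto simp: less_imp_le)

lemma sq_eq_0_iff: "sq f = 0 \<longleftrightarrow> (\<forall>x\<in>S. f x = 0)"
proof -
  have "sq f = 0 \<longleftrightarrow> (\<forall>x\<in>S. w x * (f x)\<^sup>2 = 0)"
    unfolding sq_def using w_pos fin
    by (intro sum_nonneg_eq_0_iff) (auto simp: less_imp_le)
  then show ?thesis using w_pos by force
qed

text \<open>Symmetry moves \<open>A\<close> onto the constant function \<open>1\<close>, which it
  annihilates.\<close>

lemma mean_image: "mean (A f) = 0"
proof -
  have "(\<Sum>x\<in>S. w x * (A f x * 1)) = (\<Sum>x\<in>S. w x * (f x * A (\<lambda>_. 1) x))"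
    using sym[of f "\<lambda>_. 1"] by simp
  then show ?thesis using const by (simp add: mean_def)
qed

lemma zero: "x \<in> S \<Longrightarrow> A (\<lambda>_. 0) x = 0"
  using linear[of x "\<lambda>_. 1" "-1" "\<lambda>_. 1"] by simp

lemma scale: "x \<in> S \<Longrightarrow> A (\<lambda>y. t * g y) x = t * A g x"
  using linear[of x "\<lambda>_. 0" t g] by (simp add: zero)

lemma energy_scale: "energy (\<lambda>y. t * g y) = t\<^sup>2 * energy g"
  unfolding energy_def sum_distrib_left
  by (intro sum.cong) (auto simp: scale power2_eq_square)

lemma sq_scale: "sq (\<lambda>y. t * g y) = t\<^sup>2 * sq g"
  unfolding sq_def sum_distrib_left by (intro sum.cong) (auto simp: power2_eq_square)

lemma mean_scale: "mean (\<lambda>y. t * g y) = t * mean g"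
  unfolding mean_def sum_distrib_left by (intro sum.cong) auto

lemma energy_cong: "(\<And>x. x \<in> S \<Longrightarrow> f x = g x) \<Longrightarrow> energy f = energy g"
  unfolding energy_def by (intro sum.cong) (auto simp: local_on[of f g])

lemma sq_cong: "(\<And>x. x \<in> S \<Longrightarrow> f x = g x) \<Longrightarrow> sq f = sq g"
  unfolding sq_def by (intro sum.cong) auto

lemma mean_cong: "(\<And>x. x \<in> S \<Longrightarrow> f x = g x) \<Longrightarrow> mean f = mean g"
  unfolding mean_def by (intro sum.cong) auto

lemma energy_add:
  "energy (\<lambda>y. f y + t * g y)
     = energy f + 2 * t * (\<Sum>x\<in>S. w x * (g x * A f x)) + t\<^sup>2 * energy g"
proof -
  have "energy (\<lambda>y. f y + t * g y)
      = (\<Sum>x\<in>S. w x * (f x * A f x) + t * (w x * (f x * A g x)) + t * (w x * (g x * A f x))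
          + t\<^sup>2 * (w x * (g x * A g x)))"
    unfolding energy_def by (intro sum.cong) (auto simp: linear algebra_simps power2_eq_square)
  also have "\<dots> = energy f + t * (\<Sum>x\<in>S. w x * (f x * A g x))
      + t * (\<Sum>x\<in>S. w x * (g x * A f x)) + t\<^sup>2 * energy g"
    by (simp add: energy_def sum.distrib sum_distrib_left)
  finally show ?thesis by (simp add: sym[of f g] mult.commute)
qed

lemma sq_add:
  "sq (\<lambda>y. f y + t * g y) = sq f + 2 * t * (\<Sum>x\<in>S. w x * (g x * f x)) + t\<^sup>2 * sq g"
  unfolding sq_def sum_distrib_left sum.distrib[symmetric]
  by (intro sum.cong) (auto simp: algebra_simps power2_eq_square)

lemma mean_add: "mean (\<lambda>y. f y + t * g y) = mean f + t * mean g"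
  unfolding mean_def sum_distrib_left sum.distrib[symmetric]
  by (intro sum.cong) (auto simp: algebra_simps)

text \<open>From \<open>sq f = 1\<close> each value on \<open>S\<close> is at most
  \<open>1 / sqrt (w x)\<close> in modulus, and off \<open>S\<close> it is \<open>0\<close>. So the
  set is a closed part of a box whose sides off \<open>S\<close> are single points.\<close>

lemma compact_sphere:
  "compact {f. (\<forall>x. x \<notin> S \<longrightarrow> f x = 0) \<and> mean f = 0 \<and> sq f = 1}" (is "compact ?K")
proof -
  define u where "u x = (if x \<in> S then 1 / sqrt (w x) else 0)" for x
  have *: "continuous_on UNIV mean" "continuous_on UNIV sq"
    unfolding mean_def[abs_def] sq_def[abs_def]
    by (intro continuous_intros continuous_on_product_coordinates)+
  have "f x \<in> {- u x..u x}" if "f \<in> ?K" for f x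
  proof (cases "x \<in> S")
    case True
    have "w x * (f x)\<^sup>2 \<le> sq f"
      unfolding sq_def using True fin w_pos
      by (intro member_le_sum) (auto simp: less_imp_le)
    then have "(f x)\<^sup>2 \<le> (u x)\<^sup>2"
      using that True w_pos[OF True] by (simp add: u_def power_divide field_simps)
    moreover have "0 \<le> u x" using True w_pos[OF True] by (simp add: u_def)
    ultimately show ?thesis by (metis abs_le_iff abs_le_square_iff abs_of_nonneg atLeastAtMost_iff minus_le_iff)
  qed (use that in \<open>auto simp: u_def\<close>)
  then have eq: "?K = {f. \<forall>x. f x \<in> {- u x..u x}} \<inter> ({f. mean f = 0} \<inter> {f. sq f = 1})"
    by (fastforce simp: u_def split: if_splits)
  have "closed ({f. mean f = 0} \<inter> {f. sq f = 1})"
    by (intro closed_Int closed_Collect_eq * continuous_on_const)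
  then show ?thesis
    unfolding eq by (intro compact_Int_closed compact_box_fun)
qed

text \<open>The energy attains its minimum on the compact sphere, and stationarity there is the
  eigenvalue equation. Two distinct points of \<open>S\<close> guarantee that the sphere is
  nonempty.\<close>

lemma rayleigh_minimiser:
  assumes "x \<in> S" "y \<in> S" "x \<noteq> y"
  obtains l f where "mean f = 0" "sq f = 1" "\<And>x. x \<in> S \<Longrightarrow> A f x = l * f x"
    "\<And>h. mean h = 0 \<Longrightarrow> l * sq h \<le> energy h"
proof -
  define K where "K = {f. (\<forall>x. x \<notin> S \<longrightarrow> f x = 0) \<and> mean f = 0 \<and> sq f = 1}"
  \<comment> \<open>Cutting off outside \<open>S\<close> and rescaling reduces the Rayleigh bound
    for every mean-zero function to the sphere \<open>K\<close>.\<close>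
  define nrm where "nrm h = (\<lambda>x. (1 / sqrt (sq h)) * (if x \<in> S then h x else 0))" for h
  have nrmK: "nrm h \<in> K" and energy_nrm: "energy (nrm h) = energy h / sq h"
    if "mean h = 0" "sq h \<noteq> 0" for h
  proof -
    have "sq h > 0" using that sq_nonneg[of h] by linarith
    have "energy (nrm h) = (1 / sqrt (sq h))\<^sup>2 * energy h"
      unfolding nrm_def energy_scale by (simp cong: energy_cong)
    then show "energy (nrm h) = energy h / sq h"
      using \<open>sq h > 0\<close> by (simp add: power_divide)
    have "sq (nrm h) = (1 / sqrt (sq h))\<^sup>2 * sq h"
      unfolding nrm_def sq_scale by (simp cong: sq_cong)
    moreover have "mean (nrm h) = (1 / sqrt (sq h)) * mean h"
      unfolding nrm_def mean_scale by (simp cong: mean_cong)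
    ultimately show "nrm h \<in> K"
      using that \<open>sq h > 0\<close> by (auto simp: K_def power_divide nrm_def)
  qed
  \<comment> \<open>Values reciprocal to the weights, with opposite signs, cancel in the
    mean.\<close>
  define h0 where "h0 z = (if z = x then 1 / w x else if z = y then - 1 / w y else 0)" for z
  have "mean h0 = (\<Sum>z\<in>{x,y}. w z * h0 z)"
    unfolding mean_def using assms fin by (intro sum.mono_neutral_right) (auto simp: h0_def)
  also have "\<dots> = 0"
    using assms w_pos[OF assms(1)] w_pos[OF assms(2)] by (simp add: h0_def)
  finally have "mean h0 = 0" .
  moreover have "sq h0 \<noteq> 0"
    unfolding sq_eq_0_iff using assms(1) w_pos[OF assms(1)] by (auto simp: h0_def intro!: bexI[of _ x])
  ultimately have "K \<noteq> {}" using nrmK by blast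
  moreover have "compact K" unfolding K_def by (rule compact_sphere)
  moreover have "continuous_on K energy"
    unfolding energy_def[abs_def]
    by (intro continuous_on_sum continuous_on_mult continuous_on_const
        continuous_on_product_coordinates continuous_on_subset[OF cont subset_UNIV]
        continuous_on_subset[OF continuous_on_product_coordinates subset_UNIV])
  ultimately obtain f where f: "f \<in> K" "\<And>h. h \<in> K \<Longrightarrow> energy f \<le> energy h"
    using continuous_attains_inf[of K energy] by blast
  define l where "l = energy f"
  have fm: "mean f = 0" and fs: "sq f = 1" using f(1) by (auto simp: K_def)
  have min: "l * sq h \<le> energy h" if "mean h = 0" for h
  proof (cases "sq h = 0")
    case True
    then have "energy h = 0" by (simp add: sq_eq_0_iff energy_def)
    then show ?thesis using True by simp
  next
    case False
    then have "sq h > 0" using sq_nonneg[of h] by linarith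
    moreover have "l \<le> energy h / sq h"
      using f(2)[OF nrmK[OF that False]] energy_nrm[OF that False] by (simp add: l_def)
    ultimately show ?thesis by (simp add: field_simps)
  qed
  \<comment> \<open>Perturbing the minimiser in the direction of its own residual \<open>v\<close> forces \<open>v = 0\<close>.\<close>
  define v where "v x = A f x + (- l) * f x" for x
  have vm: "mean v = 0"
    unfolding v_def[abs_def] mean_add mean_image fm by simp
  have "sq v = (\<Sum>x\<in>S. w x * (v x * A f x)) - l * (\<Sum>x\<in>S. w x * (v x * f x))"
    unfolding sq_def sum_distrib_left sum_subtractf[symmetric]
    by (intro sum.cong) (auto simp: v_def algebra_simps power2_eq_square)
  \<comment> \<open>Minimality tested on \<open>f + t * v\<close>: the terms free of
    \<open>t\<close> cancel because \<open>energy f = l\<close> and \<open>sq f = 1\<close>, and the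
    coefficient of \<open>2 * t\<close> is \<open>sq v\<close>.\<close>
  moreover have "0 \<le> 2 * t * sq v + t\<^sup>2 * (energy v - l * sq v)"
    if "sq v = (\<Sum>x\<in>S. w x * (v x * A f x)) - l * (\<Sum>x\<in>S. w x * (v x * f x))" for t
  proof -
    have "l * sq (\<lambda>y. f y + t * v y) \<le> energy (\<lambda>y. f y + t * v y)"
      by (intro min) (simp add: mean_add fm vm)
    then show ?thesis
      unfolding energy_add sq_add fs l_def[symmetric] that by (simp add: algebra_simps)
  qed
  ultimately have "sq v = 0"
    by (intro nonneg_quadratic_imp_linear_coeff_eq_0) auto
  then have "\<And>x. x \<in> S \<Longrightarrow> A f x = l * f x"
    by (simp add: sq_eq_0_iff v_def)
  with fm fs min show ?thesis using that by blast
qed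

text \<open>The Rayleigh minimum is the required eigenvalue. An eigenfunction with positive
  eigenvalue has mean zero, since images under \<open>A\<close> do, so the Rayleigh bound applies to
  it.\<close>

lemma least_positive_eigenvalue:
  assumes "x \<in> S" "y \<in> S" "x \<noteq> y"
    and pos: "\<And>f. mean f = 0 \<Longrightarrow> sq f = 1 \<Longrightarrow> 0 < energy f"
  obtains l where "0 < l" "eigenvalue_on S A l"
    "\<And>k. 0 < k \<Longrightarrow> eigenvalue_on S A k \<Longrightarrow> l \<le> k"
proof -
  obtain l f where f: "mean f = 0" "sq f = 1" "\<And>x. x \<in> S \<Longrightarrow> A f x = l * f x"
    and min: "\<And>h. mean h = 0 \<Longrightarrow> l * sq h \<le> energy h"
    using rayleigh_minimiser[OF assms(1-3)] by metis
  have rq: "energy g = k * sq g" if "\<And>x. x \<in> S \<Longrightarrow> A g x = k * g x" for g k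
    unfolding energy_def sq_def sum_distrib_left
    by (intro sum.cong) (auto simp: that power2_eq_square)
  have "0 < l" using pos[OF f(1,2)] rq[OF f(3)] f(2) by simp
  moreover have "eigenvalue_on S A l"
    unfolding eigenvalue_on_def using f(2,3) sq_eq_0_iff[of f] by (intro exI[of _ f]) auto
  moreover have "l \<le> k" if k: "0 < k" "eigenvalue_on S A k" for k
  proof -
    obtain g where g: "\<exists>x\<in>S. g x \<noteq> 0" "\<And>x. x \<in> S \<Longrightarrow> A g x = k * g x"
      using k(2) by (auto simp: eigenvalue_on_def)
    have "k * mean g = mean (A g)"
      unfolding mean_scale[symmetric] using g(2) by (intro mean_cong) auto
    then have "mean g = 0" using k(1) by (simp add: mean_image)
    then have "l * sq g \<le> k * sq g" using min[of g] rq[OF g(2)] by simp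
    moreover have "sq g > 0" using sq_nonneg[of g] sq_eq_0_iff[of g] g(1) by fastforce
    ultimately show ?thesis by simp
  qed
  ultimately show ?thesis using that by blast
qed

end

section \<open>Birth and death chains on \<open>{..N}\<close>\<close>

locale birth_death =
  fixes N :: nat and \<beta> \<delta> :: "nat \<Rightarrow> real"
  assumes N_pos: "0 < N"
    and birth_pos: "n < N \<Longrightarrow> 0 < \<beta> n" and birth_end: "\<beta> N = 0"
    and death_pos: "0 < n \<Longrightarrow> n \<le> N \<Longrightarrow> 0 < \<delta> n" and death_start: "\<delta> 0 = 0"
begin

text \<open>At \<open>n = N\<close> the outside value \<open>f (N + 1)\<close> is multiplied by
  \<open>\<beta> N = 0\<close>; at \<open>n = 0\<close> the death term vanishes.\<close>

definition neg_gen :: "(nat \<Rightarrow> real) \<Rightarrow> nat \<Rightarrow> real" where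
  "neg_gen f n = \<beta> n * (f n - f (n + 1)) + \<delta> n * (f n - f (n - 1))"

text \<open>The unnormalised reversible measure, obtained by solving detailed balance from
  \<open>weight 0 = 1\<close>.\<close>

definition weight :: "nat \<Rightarrow> real" where
  "weight n = (\<Prod>k<n. \<beta> k / \<delta> (k + 1))"

lemma weight_pos: "n \<le> N \<Longrightarrow> 0 < weight n"
  unfolding weight_def using birth_pos death_pos by (intro prod_pos) auto

lemma detailed_balance: "n < N \<Longrightarrow> weight (Suc n) * \<delta> (Suc n) = weight n * \<beta> n"
  using death_pos[of "Suc n"] by (simp add: weight_def)

text \<open>The boundary term is the flux out of \<open>{..m}\<close>; keeping it makes the
  induction work, and it disappears at \<open>m = N\<close> because
  \<open>\<beta> N = 0\<close>.\<close>

lemma summation_by_parts_upto: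
  "m \<le> N \<Longrightarrow> (\<Sum>n\<le>m. weight n * (f n * neg_gen g n))
     = (\<Sum>n<m. weight n * \<beta> n * ((f (n + 1) - f n) * (g (n + 1) - g n)))
       - weight m * \<beta> m * (f m * (g (m + 1) - g m))"
proof (induction m)
  case 0
  then show ?case by (simp add: neg_gen_def death_start algebra_simps)
next
  case (Suc m)
  have db: "weight (Suc m) * \<delta> (Suc m) = weight m * \<beta> m"
    using Suc.prems by (intro detailed_balance) auto
  have "weight (Suc m) * (f (Suc m) * neg_gen g (Suc m))
      = (weight (Suc m) * \<delta> (Suc m)) * (f (Suc m) * (g (Suc m) - g m))
        - weight (Suc m) * \<beta> (Suc m) * (f (Suc m) * (g (Suc m + 1) - g (Suc m)))"
    by (simp add: neg_gen_def algebra_simps)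
  then show ?case
    using Suc unfolding db by (simp add: algebra_simps)
qed

lemma summation_by_parts:
  "(\<Sum>n\<le>N. weight n * (f n * neg_gen g n))
     = (\<Sum>n<N. weight n * \<beta> n * ((f (n + 1) - f n) * (g (n + 1) - g n)))"
  using summation_by_parts_upto[of N f g] by (simp add: birth_end)

text \<open>Symmetry holds because both sides sum by parts to the same symmetric Dirichlet
  form.\<close>

sublocale reversible_operator "{..N}" weight neg_gen
proof
  fix f g :: "nat \<Rightarrow> real" and n :: nat and t :: real
  show "neg_gen f n = neg_gen g n" if "\<And>y. y \<in> {..N} \<Longrightarrow> f y = g y" "n \<in> {..N}"
    using that by (cases "n = N") (auto simp: neg_gen_def birth_end)
  show "neg_gen (\<lambda>y. f y + t * g y) n = neg_gen f n + t * neg_gen g n"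
    by (simp add: neg_gen_def algebra_simps)
  show "continuous_on UNIV (\<lambda>f. neg_gen f n)"
    unfolding neg_gen_def by (intro continuous_intros continuous_on_product_coordinates)
  show "(\<Sum>x\<in>{..N}. weight x * (f x * neg_gen g x)) = (\<Sum>x\<in>{..N}. weight x * (neg_gen f x * g x))"
    using summation_by_parts[of f g] summation_by_parts[of g f] by (simp add: mult_ac)
qed (auto simp: weight_pos neg_gen_def)

lemma constant_of_differences:
  assumes "\<And>n. n < N \<Longrightarrow> f (Suc n) = f n" and "m \<le> N"
  shows "f m = (f 0 :: real)"
  using assms(2) by (induction m) (auto simp: assms(1))

text \<open>The energy is a sum of squared increments with positive coefficients. If it vanished,
  \<open>f\<close> would be constant on \<open>{..N}\<close>, hence zero by its mean, against
  \<open>sq f = 1\<close>.\<close>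

lemma energy_pos:
  assumes "mean f = 0" "sq f = 1"
  shows "0 < energy f"
proof (rule ccontr)
  assume neg: "\<not> 0 < energy f"
  have eq: "energy f = (\<Sum>n<N. weight n * \<beta> n * ((f (n + 1) - f n) * (f (n + 1) - f n)))"
    unfolding energy_def by (rule summation_by_parts)
  have nn: "0 \<le> weight n * \<beta> n * ((f (n + 1) - f n) * (f (n + 1) - f n))" if "n \<in> {..<N}" for n
    using that weight_pos[of n] birth_pos[of n]
    by (intro mult_nonneg_nonneg[OF _ zero_le_square]) auto
  have "0 \<le> energy f" unfolding eq using nn by (rule sum_nonneg)
  then have "energy f = 0" using neg by linarith
  then have "\<forall>n\<in>{..<N}. weight n * \<beta> n * ((f (n + 1) - f n) * (f (n + 1) - f n)) = 0"
    using sum_nonneg_eq_0_iff[OF finite_lessThan nn] unfolding eq by simp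
  moreover have "weight n * \<beta> n \<noteq> 0" if "n < N" for n
    using that weight_pos[of n] birth_pos[of n] by simp
  ultimately have "f (Suc n) = f n" if "n < N" for n
    using that by (metis Suc_eq_plus1 eq_iff_diff_eq_0 lessThan_iff mult_eq_0_iff)
  then have const: "f n = f 0" if "n \<le> N" for n
    using that by (rule constant_of_differences)
  have "mean f = f 0 * (\<Sum>n\<le>N. weight n)"
    unfolding mean_def sum_distrib_left
  proof (rule sum.cong)
    show "weight n * f n = f 0 * weight n" if "n \<in> {..N}" for n
      using const[of n] that by simp
  qed simp
  moreover have "(\<Sum>n\<le>N. weight n) > 0" using weight_pos by (intro sum_pos) auto
  ultimately have "f 0 = 0" using assms(1) by auto
  then have "f n = 0" if "n \<le> N" for n using const[OF that] by simp
  then have "sq f = 0" by (simp add: sq_eq_0_iff)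
  then show False using assms(2) by simp
qed

text \<open>The increments \<open>f (n + 1) - f n\<close> of an eigenfunction satisfy a tridiagonal eigenvalue
  equation; the bound is read off where the increment is largest relative to \<open>u\<close>. For \<open>n = 0\<close>
  the junk value \<open>u (0 - 1)\<close> is multiplied by \<open>\<delta> 0 = 0\<close>.\<close>

lemma eigenvalue_ge:
  assumes "eigenvalue_on {..N} neg_gen l" "0 < l"
    and u: "\<And>n. 0 < u n"
    and \<kappa>: "\<And>n. n < N \<Longrightarrow>
      \<kappa> * u n \<le> (\<beta> n + \<delta> (n + 1)) * u n - \<beta> (n + 1) * u (n + 1) - \<delta> n * u (n - 1)"
  shows "\<kappa> \<le> l"
proof -
  obtain f where f: "\<exists>n\<le>N. f n \<noteq> 0" "\<And>n. n \<le> N \<Longrightarrow> neg_gen f n = l * f n"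
    using assms(1) by (auto simp: eigenvalue_on_def)
  define g where "g n = f (n + 1) - f n" for n
  \<comment> \<open>Without a nonzero increment \<open>f\<close> would be constant and
    \<open>neg_gen f 0 = 0\<close>, which \<open>0 < l\<close> excludes.\<close>
  have "\<exists>n<N. g n \<noteq> 0"
  proof (rule ccontr)
    assume "\<not> ?thesis"
    then have "f (Suc n) = f n" if "n < N" for n
      using that by (auto simp: g_def)
    then have const: "f n = f 0" if "n \<le> N" for n
      using that by (rule constant_of_differences)
    have "neg_gen f 0 = 0"
      using const[of 1] N_pos by (simp add: neg_gen_def death_start)
    then have "f 0 = 0" using f(2)[of 0] \<open>0 < l\<close> by simp
    then show False using f(1) const by metis
  qed
  then obtain k where k: "k < N" "g k \<noteq> 0" by blast
  define r where "r n = \<bar>g n\<bar> / u n" for n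
  \<comment> \<open>A maximiser of \<open>r\<close>, expressed as a minimiser of
    \<open>- r\<close>.\<close>
  define m where "m = arg_min_on (\<lambda>n. - r n) {..<N}"
  have m: "m < N" "\<And>n. n < N \<Longrightarrow> r n \<le> r m"
    using arg_min_if_finite(1)[of "{..<N}" "\<lambda>n. - r n"] arg_min_least[of "{..<N}" _ "\<lambda>n. - r n"] N_pos
    unfolding m_def by (simp_all add: lessThan_empty_iff)
  have "0 < r k" using k u by (simp add: r_def)
  then have rm: "0 < r m" using m(2)[OF k(1)] by linarith
  have bd: "\<bar>g n\<bar> \<le> r m * u n" if "n < N" for n
    using m(2)[OF that] u[of n] by (simp add: r_def[of n] field_simps)
  have gm: "\<bar>g m\<bar> = r m * u m" using u[of m] by (simp add: r_def)
  \<comment> \<open>Differencing the eigenvalue equations at \<open>m + 1\<close> and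
    \<open>m\<close> gives the equation for the increments.\<close>
  have "neg_gen f (Suc m) - neg_gen f m = l * g m"
    using f(2)[of m] f(2)[of "Suc m"] m(1) by (simp add: g_def algebra_simps)
  moreover have "\<delta> m * (f m - f (m - 1)) = \<delta> m * g (m - 1)"
    by (cases m) (auto simp: death_start g_def)
  then have "neg_gen f m = \<delta> m * g (m - 1) - \<beta> m * g m"
    by (simp add: neg_gen_def g_def[of m] algebra_simps)
  moreover have "neg_gen f (Suc m) = \<delta> (m + 1) * g m - \<beta> (m + 1) * g (m + 1)"
    by (simp add: neg_gen_def g_def algebra_simps)
  ultimately have "l * g m = (\<beta> m + \<delta> (m + 1)) * g m - \<beta> (m + 1) * g (m + 1) - \<delta> m * g (m - 1)"
    by (simp add: algebra_simps)
  then have eq: "(\<beta> m + \<delta> (m + 1)) * g m = l * g m + \<beta> (m + 1) * g (m + 1) + \<delta> m * g (m - 1)"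
    by linarith
  \<comment> \<open>For \<open>m + 1 = N\<close> the increment lies outside the range of the
    maximum, but its coefficient \<open>\<beta> N\<close> is zero.\<close>
  have b1: "\<bar>\<beta> (m + 1) * g (m + 1)\<bar> \<le> \<beta> (m + 1) * (r m * u (m + 1))"
  proof (cases "m + 1 < N")
    case True
    then show ?thesis using bd[OF True] birth_pos[OF True] by (simp add: abs_mult)
  next
    case False
    then have "m + 1 = N" using m(1) by simp
    then show ?thesis by (simp add: birth_end)
  qed
  have b2: "\<bar>\<delta> m * g (m - 1)\<bar> \<le> \<delta> m * (r m * u (m - 1))"
    using bd[of "m - 1"] death_pos[of m] m(1) by (cases m) (auto simp: abs_mult death_start)
  have "0 < \<beta> m + \<delta> (m + 1)" using birth_pos[of m] death_pos[of "m + 1"] m(1) by simp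
  then have "(\<beta> m + \<delta> (m + 1)) * (r m * u m) = \<bar>(\<beta> m + \<delta> (m + 1)) * g m\<bar>"
    using gm by (simp add: abs_mult)
  also have "\<dots> \<le> \<bar>l\<bar> * (r m * u m) + \<beta> (m + 1) * (r m * u (m + 1)) + \<delta> m * (r m * u (m - 1))"
  proof -
    have "\<bar>l * g m\<bar> = \<bar>l\<bar> * (r m * u m)" using gm by (simp add: abs_mult)
    then show ?thesis unfolding eq using b1 b2 by linarith
  qed
  finally have "r m * ((\<beta> m + \<delta> (m + 1)) * u m - \<beta> (m + 1) * u (m + 1) - \<delta> m * u (m - 1))
      \<le> r m * (\<bar>l\<bar> * u m)"
    by (simp add: algebra_simps)
  then have "\<kappa> * u m \<le> \<bar>l\<bar> * u m"
    using rm \<kappa>[OF m(1)] by simp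
  then show ?thesis using u[of m] \<open>0 < l\<close> by simp
qed

end

section \<open>Reduction of the Fleming-Viot process to the birth and death chain\<close>

definition FV_birth :: "real \<Rightarrow> (nat \<Rightarrow> real) \<Rightarrow> nat \<Rightarrow> nat \<Rightarrow> real" where
  "FV_birth b p0 N n = (real N - real n) * (b + p0 2 * (real n / (real N - 1)))"

definition FV_death :: "real \<Rightarrow> (nat \<Rightarrow> real) \<Rightarrow> nat \<Rightarrow> nat \<Rightarrow> real" where
  "FV_death a p0 N n = real n * (a + p0 1 * ((real N - real n) / (real N - 1)))"

lemma FV_birth_death:
  assumes "0 < a" "0 < b" "0 \<le> p0 1" "0 \<le> p0 2" "2 \<le> N"
  shows "birth_death N (FV_birth b p0 N) (FV_death a p0 N)"
  using assms unfolding FV_birth_def FV_death_def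
  by unfold_locales (auto intro!: mult_pos_pos add_pos_nonneg)

lemma FV_neg_gen:
  assumes "birth_death N (FV_birth b p0 N) (FV_death a p0 N)" "n + m = N"
  shows "- FV_generator a b p0 N f (n, m)
    = birth_death.neg_gen (FV_birth b p0 N) (FV_death a p0 N) (\<lambda>n. f (n, N - n)) n"
proof -
  \<comment> \<open>The factor \<open>n\<close> stays inside: for \<open>n = 0\<close> the point
    \<open>T12 (n, m)\<close> lies outside the state space, and both sides are zero. The same holds
    for \<open>m\<close> and \<open>T21\<close>.\<close>
  have "n * (f (T12 (n, m)) - f (n, m)) = n * (f (n - 1, N - (n - 1)) - f (n, N - n))"
    using assms(2) by (cases n) (auto simp: T12_def)
  moreover have "m * (f (T21 (n, m)) - f (n, m)) = m * (f (n + 1, N - (n + 1)) - f (n, N - n))"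
    using assms(2) by (cases m) (auto simp: T21_def)
  moreover have "FV_generator a b p0 N f (n, m)
      = (a + p0 1 * (real m / (real N - 1))) * (n * (f (T12 (n, m)) - f (n, m)))
        + (b + p0 2 * (real n / (real N - 1))) * (m * (f (T21 (n, m)) - f (n, m)))"
    by (simp add: FV_generator_def mult_ac)
  moreover have m: "real m = real N - real n" using assms(2) by auto
  ultimately have "FV_generator a b p0 N f (n, m)
      = (a + p0 1 * (real m / (real N - 1))) * (n * (f (n - 1, N - (n - 1)) - f (n, N - n)))
        + (b + p0 2 * (real n / (real N - 1))) * (m * (f (n + 1, N - (n + 1)) - f (n, N - n)))"
    by presburger
  also have "\<dots> = FV_death a p0 N n * (f (n - 1, N - (n - 1)) - f (n, N - n))
      + FV_birth b p0 N n * (f (n + 1, N - (n + 1)) - f (n, N - n))"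
    unfolding FV_death_def FV_birth_def m by (simp only: mult_ac)
  finally show ?thesis
    by (simp only: birth_death.neg_gen_def[OF assms(1)]) (simp add: algebra_simps)
qed

text \<open>Eigenfunctions are transported along the bijection \<open>n \<mapsto> (n, N - n)\<close>
  from \<open>{..N}\<close> to the state space.\<close>

lemma eigenvalue_on_FV_iff:
  assumes "birth_death N (FV_birth b p0 N) (FV_death a p0 N)"
  shows "eigenvalue_on (FV_states N) (\<lambda>f \<eta>. - FV_generator a b p0 N f \<eta>) l \<longleftrightarrow>
    eigenvalue_on {..N} (birth_death.neg_gen (FV_birth b p0 N) (FV_death a p0 N)) l"
    (is "?L \<longleftrightarrow> eigenvalue_on _ ?A _")
proof
  assume ?L
  then obtain f \<eta> where f: "\<eta> \<in> FV_states N" "f \<eta> \<noteq> 0"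
    "\<And>\<eta>. \<eta> \<in> FV_states N \<Longrightarrow> - FV_generator a b p0 N f \<eta> = l * f \<eta>"
    by (auto simp: eigenvalue_on_def)
  have "?A (\<lambda>n. f (n, N - n)) n = l * f (n, N - n)" if "n \<le> N" for n
    using FV_neg_gen[OF assms, of n "N - n" f] f(3)[of "(n, N - n)"] that by (simp add: FV_states_def)
  moreover have "fst \<eta> \<le> N" "\<eta> = (fst \<eta>, N - fst \<eta>)"
    using f(1) by (auto simp: FV_states_def prod_eq_iff)
  ultimately show "eigenvalue_on {..N} ?A l"
    unfolding eigenvalue_on_def using f(2)
    by (intro exI[of _ "\<lambda>n. f (n, N - n)"]) (auto intro!: bexI[of _ "fst \<eta>"])
next
  assume "eigenvalue_on {..N} ?A l"
  then obtain g n where g: "n \<le> N" "g n \<noteq> 0" "\<And>n. n \<le> N \<Longrightarrow> ?A g n = l * g n"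
    by (auto simp: eigenvalue_on_def)
  have "- FV_generator a b p0 N (\<lambda>\<eta>. g (fst \<eta>)) \<eta> = l * g (fst \<eta>)" if "\<eta> \<in> FV_states N" for \<eta>
    using that FV_neg_gen[OF assms, of "fst \<eta>" "snd \<eta>" "\<lambda>\<eta>. g (fst \<eta>)"] g(3)[of "fst \<eta>"]
    by (auto simp: FV_states_def)
  moreover have "(n, N - n) \<in> FV_states N" using g(1) by (simp add: FV_states_def)
  ultimately show ?L
    unfolding eigenvalue_on_def using g(2)
    by (intro exI[of _ "\<lambda>\<eta>. g (fst \<eta>)"]) (force intro!: bexI[of _ "(n, N - n)"])
qed

text \<open>This gives the \<open>LEAST\<close> in the definition of the gap its meaning: the
  smallest positive eigenvalue exists.\<close>

lemma FV_spectral_gap_eigenvalue: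
  assumes "0 < a" "0 < b" "0 \<le> p0 1" "0 \<le> p0 2" "2 \<le> N"
  shows "0 < FV_spectral_gap a b p0 N"
    and "eigenvalue_on (FV_states N) (\<lambda>f \<eta>. - FV_generator a b p0 N f \<eta>) (FV_spectral_gap a b p0 N)"
proof -
  interpret birth_death N "FV_birth b p0 N" "FV_death a p0 N"
    using assms by (rule FV_birth_death)
  obtain l where l: "0 < l" "eigenvalue_on {..N} neg_gen l"
    "\<And>k. 0 < k \<Longrightarrow> eigenvalue_on {..N} neg_gen k \<Longrightarrow> l \<le> k"
    using least_positive_eigenvalue[of 0 N] N_pos energy_pos by auto
  have "FV_spectral_gap a b p0 N = l"
    unfolding FV_spectral_gap_def eigenvalue_on_FV_iff[OF birth_death_axioms]
    using l by (intro Least_equality) auto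
  then show "0 < FV_spectral_gap a b p0 N"
    "eigenvalue_on (FV_states N) (\<lambda>f \<eta>. - FV_generator a b p0 N f \<eta>) (FV_spectral_gap a b p0 N)"
    using l(1,2) unfolding eigenvalue_on_FV_iff[OF birth_death_axioms] by auto
qed

section \<open>Exchange of the two sites\<close>

lemma FV_generator_swap:
  "FV_generator a b p0 N (f \<circ> prod.swap) (prod.swap \<eta>)
     = FV_generator b a (\<lambda>i. p0 (3 - i)) N f \<eta>"
  by (simp add: FV_generator_def T12_def T21_def)

lemma eigenvalue_on_FV_swap:
  assumes "eigenvalue_on (FV_states N) (\<lambda>f \<eta>. - FV_generator b a (\<lambda>i. p0 (3 - i)) N f \<eta>) l"
  shows "eigenvalue_on (FV_states N) (\<lambda>f \<eta>. - FV_generator a b p0 N f \<eta>) l"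
proof -
  obtain f \<eta> where f: "\<eta> \<in> FV_states N" "f \<eta> \<noteq> 0"
    "\<And>\<eta>. \<eta> \<in> FV_states N \<Longrightarrow> - FV_generator b a (\<lambda>i. p0 (3 - i)) N f \<eta> = l * f \<eta>"
    using assms by (auto simp: eigenvalue_on_def)
  have swap: "prod.swap \<xi> \<in> FV_states N \<longleftrightarrow> \<xi> \<in> FV_states N" for \<xi>
    by (auto simp: FV_states_def)
  have "- FV_generator a b p0 N (f \<circ> prod.swap) \<xi> = l * (f \<circ> prod.swap) \<xi>"
    if "\<xi> \<in> FV_states N" for \<xi>
    using FV_generator_swap[of a b p0 N f "prod.swap \<xi>"] f(3)[of "prod.swap \<xi>"] that by (simp add: swap)
  then show ?thesis
    unfolding eigenvalue_on_def using f(1,2)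
    by (intro exI[of _ "f \<circ> prod.swap"]) (auto intro!: bexI[of _ "prod.swap \<eta>"] simp: swap)
qed

lemma FV_spectral_gap_swap:
  "FV_spectral_gap b a (\<lambda>i. p0 (3 - i)) N = FV_spectral_gap a b p0 N"
proof -
  \<comment> \<open>Under truncated subtraction \<open>3 - (3 - i)\<close> differs from
    \<open>i\<close> for \<open>i > 3\<close>, but the generator reads \<open>p0\<close> only at
    \<open>1\<close> and \<open>2\<close>.\<close>
  have eq: "FV_generator a b (\<lambda>i. p0 (3 - (3 - i))) N = FV_generator a b p0 N"
    by (intro ext) (simp add: FV_generator_def)
  have "eigenvalue_on (FV_states N) (\<lambda>f \<eta>. - FV_generator b a (\<lambda>i. p0 (3 - i)) N f \<eta>) l \<longleftrightarrow>
      eigenvalue_on (FV_states N) (\<lambda>f \<eta>. - FV_generator a b p0 N f \<eta>) l" for l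
    using eigenvalue_on_FV_swap[of N b a p0 l] eigenvalue_on_FV_swap[of N a b "\<lambda>i. p0 (3 - i)" l]
    by (auto simp: eq)
  then show ?thesis by (simp add: FV_spectral_gap_def)
qed

section \<open>Lower bound uniform in \<open>N\<close>\<close>

lemma FV_spectral_gap_ge:
  assumes "0 < a" "0 < b" "0 \<le> p0 1" "p0 1 \<le> p0 2" "2 \<le> N"
    and large: "p0 2 / (real N - 1) \<le> b / 2"
  shows "b / 2 \<le> FV_spectral_gap a b p0 N"
proof -
  have "0 \<le> p0 2" using assms by linarith
  interpret birth_death N "FV_birth b p0 N" "FV_death a p0 N"
    using assms \<open>0 \<le> p0 2\<close> by (intro FV_birth_death)
  let ?u = "\<lambda>n::nat. 1 / (real n + 1)"
  show ?thesis
  proof (rule eigenvalue_ge)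
    show "eigenvalue_on {..N} neg_gen (FV_spectral_gap a b p0 N)" "0 < FV_spectral_gap a b p0 N"
      using FV_spectral_gap_eigenvalue[of a b p0 N] assms \<open>0 \<le> p0 2\<close>
      unfolding eigenvalue_on_FV_iff[OF birth_death_axioms] by auto
    show "0 < ?u n" for n by simp
    fix n assume n: "n < N"
    define x M q p where "x = real n" and "M = real N" and "q = p0 2 / (M - 1)" and "p = p0 1 / (M - 1)"
    have M: "2 \<le> M" using assms(5) by (simp add: M_def)
    have x: "0 \<le> x" "x + 1 \<le> M" using n by (auto simp: x_def M_def)
    have pq: "p \<le> q" "0 \<le> p" unfolding p_def q_def using assms M by (auto intro: divide_right_mono)
    have q: "q \<le> b / 2" using large by (simp add: q_def M_def)
    define B where "B t = (M - t) * (b + q * t)" for t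
    define D where "D t = t * (a + p * (M - t))" for t
    have B: "FV_birth b p0 N n = B x" "FV_birth b p0 N (n + 1) = B (x + 1)"
      by (auto simp: FV_birth_def B_def x_def M_def q_def add.commute)
    have D: "FV_death a p0 N n = D x" "FV_death a p0 N (n + 1) = D (x + 1)"
      by (auto simp: FV_death_def D_def x_def M_def p_def add.commute)
    \<comment> \<open>The decay of \<open>?u\<close> leaves a share of the upward drift, the term
      with \<open>M + 1\<close>; \<open>q * (x + 1)\<close> is kept to absorb the loss from the
      deaths.\<close>
    have birth: "B x - B (x + 1) * (x + 1) / (x + 2)
        = (M + 1) / (x + 2) * (b - q) + q * (x + 1)"
      using x by (simp add: B_def field_simps)
    \<comment> \<open>For \<open>n > 0\<close> this is an equality, as
      \<open>?u (n - 1) = 1 / x\<close>; for \<open>n = 0\<close> the left side is zero because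
      \<open>D 0 = 0\<close>.\<close>
    have "D x * ?u (n - 1) \<le> a + p * (M - x)"
    proof (cases n)
      case 0
      then show ?thesis using assms(1) pq M x by (simp add: D_def x_def)
    next
      case (Suc k)
      then show ?thesis by (simp add: D_def x_def add.commute)
    qed
    then have "(x + 1) * (D x * ?u (n - 1)) \<le> (x + 1) * (a + p * (M - x))"
      using x by (intro mult_left_mono) auto
    then have death: "D (x + 1) - (x + 1) * (D x * ?u (n - 1)) \<ge> - p * (x + 1)"
      by (simp add: D_def algebra_simps)
    \<comment> \<open>The first factor is at least \<open>1\<close> because
      \<open>x + 1 \<le> M\<close>, the second at least \<open>b / 2\<close> because
      \<open>q \<le> b / 2\<close>.\<close>
    have "b / 2 \<le> (M + 1) / (x + 2) * (b - q)"
      using x q assms(2) mult_mono[of 1 "(M + 1) / (x + 2)" "b / 2" "b - q"] by auto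
    moreover have "p * (x + 1) \<le> q * (x + 1)"
      using pq x by (intro mult_right_mono) auto
    ultimately have "b / 2 \<le> B x - B (x + 1) * (x + 1) / (x + 2)
        + D (x + 1) - (x + 1) * (D x * ?u (n - 1))"
      using birth death by linarith
    then have "b / 2 * ?u n \<le> (B x - B (x + 1) * (x + 1) / (x + 2)
        + D (x + 1) - (x + 1) * (D x * ?u (n - 1))) * ?u n"
      by (intro mult_right_mono) auto
    also have "\<dots> = (B x + D (x + 1)) * ?u n - B (x + 1) * ?u (n + 1) - D x * ?u (n - 1)"
    proof -
      have u: "?u n = 1 / (x + 1)" "?u (n + 1) = 1 / (x + 2)" by (auto simp: x_def)
      have *: "(X - Z * r / s + X' - r * Y) * (1 / r) = (X + X') * (1 / r) - Z * (1 / s) - Y"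
        if "0 < r" "0 < s" for X X' Y Z r s :: real
        using that by (simp add: field_simps)
      show ?thesis unfolding u by (rule *) (use x in auto)
    qed
    finally show "b / 2 * ?u n \<le> (FV_birth b p0 N n + FV_death a p0 N (n + 1)) * ?u n
        - FV_birth b p0 N (n + 1) * ?u (n + 1) - FV_death a p0 N n * ?u (n - 1)"
      unfolding B D .
  qed
qed

lemma FV_spectral_gap_uniform:
  assumes "0 < a" "0 < b" "0 \<le> p0 1" "p0 1 \<le> p0 2"
  shows "\<exists>c>0. \<forall>N\<ge>2. c < FV_spectral_gap a b p0 N"
proof -
  \<comment> \<open>From \<open>K\<close> on, \<open>p0 2 / (real N - 1) \<le> b / 2\<close> holds,
    so the bound \<open>b / 2\<close> applies; the smaller \<open>N\<close> contribute finitely many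
    positive gaps.\<close>
  obtain K where K: "2 * p0 2 / b + 1 < real K" using reals_Archimedean2 by blast
  define G where "G = insert (b / 2) (FV_spectral_gap a b p0 ` {2..<K})"
  have G: "finite G" "G \<noteq> {}" by (auto simp: G_def)
  have "\<forall>g\<in>G. 0 < g"
    using FV_spectral_gap_eigenvalue(1)[of a b p0] assms by (auto simp: G_def)
  then have "0 < Min G" using G by simp
  moreover have "Min G \<le> FV_spectral_gap a b p0 N" if "2 \<le> N" for N
  proof (cases "N < K")
    case True
    then show ?thesis using that G by (intro Min_le) (auto simp: G_def)
  next
    case False
    then have "2 * p0 2 / b < real N - 1" using K by linarith
    then have "p0 2 / (real N - 1) \<le> b / 2"
      using assms that by (simp add: field_simps)
    then have "b / 2 \<le> FV_spectral_gap a b p0 N"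
      using assms that by (intro FV_spectral_gap_ge)
    moreover have "Min G \<le> b / 2" using G by (intro Min_le) (auto simp: G_def)
    ultimately show ?thesis by linarith
  qed
  ultimately show ?thesis
    \<comment> \<open>Halving the minimum makes the inequality strict.\<close>
    by (intro exI[of _ "Min G / 2"]) force
qed

theorem theorem3p4:
  fixes a b \<rho> :: real and p0 :: "nat \<Rightarrow> real"
  assumes "a > 0" and "b > 0"
    and "p0 1 \<ge> 0" and "p0 2 \<ge> 0" and "p0 1 + p0 2 > 0"
    and "\<rho> = a + b - \<bar>p0 1 - p0 2\<bar>"
    and "\<rho> \<le> 0"
  shows "\<exists>c>0. \<forall>N\<ge>2. FV_spectral_gap a b p0 N > c"
proof (cases "p0 1 \<le> p0 2")
  case True
  then show ?thesis using assms by (intro FV_spectral_gap_uniform) auto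
next
  case False
  \<comment> \<open>Relabelling the sites by \<open>i \<mapsto> 3 - i\<close> exchanges
    \<open>a\<close> with \<open>b\<close> and reverses the order of the two killing rates.\<close>
  then have "\<exists>c>0. \<forall>N\<ge>2. c < FV_spectral_gap b a (\<lambda>i. p0 (3 - i)) N"
    using assms by (intro FV_spectral_gap_uniform) auto
  then show ?thesis by (simp add: FV_spectral_gap_swap)
qed

end
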